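(* Let $(\Omega,\mathcal F,(\mathcal F_n)_{n=0,1,2,\dots})$ be a discrete-time filtered space with $\mathcal F=\bigvee_n\mathcal F_n$, let $\mu,P$ be probability measures on it with $\mu\ll P$, let $z$ be the density process of $\mu$ with respect to $P$, and let $T$ be a stopping time. Then, $P$-a.s., $$\mathbf E_P[z_T|\mathcal F_{T-}]=\begin{cases}z_T,&\omega\in\{T=0\}\cup\{T=\infty\},\\[4pt]\dfrac{\mathbf E_P\big[z_n1_{\{T=n\}}\big|\mathcal F_{n-1}\big]}{\mathbf E_P\big[1_{\{T=n\}}\big|\mathcal F_{n-1}\big]},&\omega\in\{T=n\},\ n\ge1.\end{cases}$$
   Context: $T$ takes values in $\{0,1,2,\dots\}\cup\{\infty\}$. $\mathcal F_{T-}$ is the $\sigma$-algebra generated by $\mathcal F_0$ and the sets $A\cap\{n<T\}$, $A\in\mathcal F_n$, $n\ge0$. $z_n=d\mu_n/dP_n$ (restrictions to $\mathcal F_n$) and $z_\infty=d\mu/dP$. *)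

theory Defs
  imports "HOL-Probability.Probability"
begin

text \<open>
  The filtration extended to the index set \<open>{0, 1, 2, \<dots>} \<union> {\<infinity>}\<close> by
  \<open>\<F>\<^sub>\<infinity> = \<Or>\<^sub>n \<F>\<^sub>n\<close>, so that times with values in \<^typ>\<open>enat\<close> can be related to it. Since
  \<open>{T \<le> \<infinity>}\<close> is the whole space, \<open>stopping_time (extended_filtration \<Omega> F) T\<close> amounts to
  \<open>{T \<le> n} \<in> \<F>\<^sub>n\<close> for all finite \<open>n\<close>.
\<close>

definition extended_filtration :: "'a set \<Rightarrow> (nat \<Rightarrow> 'a measure) \<Rightarrow> enat \<Rightarrow> 'a measure" where
  "extended_filtration \<Omega> F t =
    (case t of enat n \<Rightarrow> F n | \<infinity> \<Rightarrow> sigma \<Omega> (\<Union>n. sets (F n)))"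

definition strict_past :: "'a set \<Rightarrow> (nat \<Rightarrow> 'a measure) \<Rightarrow> ('a \<Rightarrow> enat) \<Rightarrow> 'a measure" where
  "strict_past \<Omega> F T =
    sigma \<Omega> (sets (F 0) \<union> {A \<inter> {\<omega> \<in> \<Omega>. enat n < T \<omega>} | A n. A \<in> sets (F n)})"

text \<open>
  Densities are determined only up to null sets, so this is a predicate: each \<open>z n\<close> may be any real,
  \<open>\<F>\<^sub>n\<close>-measurable version of \<open>d\<mu>\<^sub>n/dP\<^sub>n\<close>, and \<open>z \<infinity>\<close> any version of \<open>d\<mu>/dP\<close>.
\<close>

definition density_process ::
  "'a measure \<Rightarrow> 'a measure \<Rightarrow> (nat \<Rightarrow> 'a measure) \<Rightarrow> (enat \<Rightarrow> 'a \<Rightarrow> real) \<Rightarrow> bool" where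
  "density_process P \<mu> F z \<longleftrightarrow>
    (\<forall>n. z (enat n) \<in> borel_measurable (F n) \<and>
      (AE \<omega> in restr_to_subalg P (F n).
        z (enat n) \<omega> = enn2real (RN_deriv (restr_to_subalg P (F n)) (restr_to_subalg \<mu> (F n)) \<omega>))) \<and>
    z \<infinity> \<in> borel_measurable P \<and>
    (AE \<omega> in P. z \<infinity> \<omega> = enn2real (RN_deriv P \<mu> \<omega>))"

text \<open>
  A conditional probability of \<open>B\<close> is almost surely positive on \<open>B\<close>, so a quotient with this denominator
  does not involve the convention \<open>x / 0 = 0\<close> there.
\<close>

lemma cond_prob_pos:
  assumes P: "prob_space P" and G: "subalgebra P G" and B: "B \<in> sets P"
  shows "AE \<omega> in P. \<omega> \<in> B \<longrightarrow> 0 < real_cond_exp P G (indicator B) \<omega>"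
proof -
  interpret prob_space P by (fact P)
  interpret finite_measure_subalgebra P G by unfold_locales (fact G)
  let ?e = "real_cond_exp P G (indicator B)"
  define N where "N = {\<omega> \<in> space G. ?e \<omega> \<le> 0}"
  have NG: "N \<in> sets G" unfolding N_def by measurable
  have NP: "N \<in> sets P" using NG G by (auto simp: subalgebra_def)
  have intB: "integrable P (indicator B :: _ \<Rightarrow> real)" using B by (simp add: emeasure_eq_measure)
  have nn: "AE \<omega> in P. 0 \<le> ?e \<omega>"
    using B by (intro real_cond_exp_pos) auto
  have "(\<integral>\<omega>\<in>N. indicator B \<omega> \<partial>P) = (\<integral>\<omega>\<in>N. ?e \<omega> \<partial>P)"
    by (rule real_cond_exp_intA[OF intB NG])
  also have "\<dots> = (\<integral>\<omega>. 0 \<partial>P)"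
    unfolding set_lebesgue_integral_def
  proof (rule integral_cong_AE)
    show "(\<lambda>\<omega>. indicator N \<omega> *\<^sub>R ?e \<omega>) \<in> borel_measurable P"
      using NP by measurable
    show "AE \<omega> in P. indicator N \<omega> *\<^sub>R ?e \<omega> = 0"
      using nn by eventually_elim (auto simp: N_def indicator_def)
  qed simp
  finally have "(\<integral>\<omega>. indicator (N \<inter> B) \<omega> \<partial>P) = (0::real)"
    by (simp add: set_lebesgue_integral_def indicator_inter_arith)
  hence "measure P (N \<inter> B) = 0" using NP B by (simp add: Int_absorb2 sets.sets_into_space)
  hence "N \<inter> B \<in> null_sets P" using NP B by (auto simp: null_sets_def emeasure_eq_measure)
  hence "AE \<omega> in P. \<omega> \<notin> N \<inter> B" by (rule AE_not_in)
  moreover have sp: "space G = space P" using G by (simp add: subalgebra_def)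
  ultimately show ?thesis using AE_space by eventually_elim (auto simp: N_def sp)
qed

end

theory Submission
  imports Defs
begin

text \<open>
  On \<open>{T = t}\<close> the \<open>\<sigma>\<close>-algebra \<open>\<F>\<^sub>T\<^sub>-\<close> has the same trace as the strict past \<open>\<F>\<^sub>t\<^sub>-\<close> of the
  constant time \<open>t\<close>, which is \<open>\<F>\<^sub>0\<close>, \<open>\<F>\<^sub>n\<^sub>-\<^sub>1\<close> or \<open>\<F>\<close> for \<open>t = 0\<close>, \<open>t = n \<ge> 1\<close> or \<open>t = \<infinity>\<close>.
  Suppose that \<open>\<G>\<close> and \<open>\<H>\<close> have the same trace on a set \<open>D \<in> \<G>\<close>. If \<open>X\<close> agrees on \<open>D\<close> with an
  \<open>\<H>\<close>-measurable function, then \<open>E[X | \<G>] = X\<close> on \<open>D\<close>; this applies for \<open>t = 0\<close> and \<open>t = \<infinity>\<close>.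
  In general, \<open>E[X | \<G>]\<close> agrees on \<open>D\<close> with some \<open>\<H>\<close>-measurable \<open>h\<close>, and
  \<open>E[X 1\<^sub>D | \<H>] = E[h 1\<^sub>D | \<H>] = h E[1\<^sub>D | \<H>]\<close>, which is Bayes' formula for \<open>E[X | \<G>]\<close> on \<open>D\<close>.
  The variable \<open>z\<^sub>T\<close> is integrable because \<open>\<mu>\<close> has density \<open>z\<^sub>t\<close> on \<open>{T = t}\<close> for every \<open>t\<close>, so that
  \<open>E\<^sub>P \<bar>z\<^sub>T\<bar>\<close> is the sum of all \<open>\<mu>{T = t}\<close>, which is \<open>1\<close>.
\<close>

section \<open>Conditional expectations and traces of \<open>\<sigma>\<close>-algebras\<close>

lemma sets_restrict_space_sigma:
  assumes "A \<subseteq> Pow \<Omega>" "D \<subseteq> \<Omega>"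
  shows "sets (restrict_space (sigma \<Omega> A) D) = sigma_sets D {B \<inter> D | B. B \<in> A}"
proof -
  have "{B \<inter> D | B. B \<in> A} \<subseteq> Pow D" "(\<lambda>x. x) \<in> D \<rightarrow> \<Omega>"
    using assms(2) by auto
  moreover have "sets (restrict_space (sigma \<Omega> A) D) = sets (vimage_algebra D (\<lambda>x. x) (sigma \<Omega> A))"
    using assms by (intro restrict_space_eq_vimage_algebra) simp
  ultimately show ?thesis
    using assms(1) by (simp add: vimage_algebra_sigma)
qed

lemma borel_measurable_restrict_space_extend:
  fixes f :: "'a \<Rightarrow> real"
  assumes [measurable]: "f \<in> borel_measurable (restrict_space M D)"
  obtains g where "g \<in> borel_measurable M" "\<And>x. x \<in> D \<Longrightarrow> x \<in> space M \<Longrightarrow> g x = f x"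
proof -
  have "{x \<in> space (restrict_space M D). real_of_rat r < f x} \<in> sets (restrict_space M D)" for r
    by measurable
  then have "\<exists>A. A \<in> sets M \<and> {x \<in> D \<inter> space M. real_of_rat r < f x} = D \<inter> A" for r
    by (auto simp: sets_restrict_space space_restrict_space)
  then obtain A where [measurable]: "\<And>r. A r \<in> sets M"
    and less_f: "\<And>r. {x \<in> D \<inter> space M. real_of_rat r < f x} = D \<inter> A r"
    by metis
  define g where "g x = (SUP r. if x \<in> A r then ereal (real_of_rat r) else -\<infinity>)" for x
  have "g x = ereal (f x)" if x: "x \<in> D" "x \<in> space M" for x
  proof (rule antisym)
    have mem_A: "x \<in> A r \<longleftrightarrow> real_of_rat r < f x" for r
      using less_f[of r] x by blast
    show "g x \<le> ereal (f x)"
      unfolding g_def by (rule SUP_least) (auto simp: mem_A)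
    show "ereal (f x) \<le> g x"
    proof (rule ereal_le_real)
      fix y assume y: "g x \<le> ereal y"
      have "real_of_rat r \<le> y" if "real_of_rat r < f x" for r
      proof -
        have "ereal (real_of_rat r) \<le> g x"
          unfolding g_def using that by (intro SUP_upper2[of r]) (auto simp: mem_A)
        with y show ?thesis
          using order_trans by fastforce
      qed
      then show "ereal (f x) \<le> ereal y"
        by (metis ereal_less_eq(3) not_le of_rat_dense)
    qed
  qed
  moreover have "g \<in> borel_measurable M"
    unfolding g_def by measurable
  ultimately show thesis
    by (intro that[of "\<lambda>x. real_of_ereal (g x)"]) auto
qed

lemma (in sigma_finite_subalgebra) real_cond_exp_eq_on_trace:
  assumes D: "D \<in> sets F" and trace: "sets (restrict_space F D) = sets (restrict_space H D)"
    and f: "f \<in> borel_measurable H" and X: "integrable M X"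
    and X_eq_f: "\<And>x. x \<in> D \<Longrightarrow> X x = f x"
  shows "AE x in M. x \<in> D \<longrightarrow> real_cond_exp M F X x = X x"
proof -
  have "f \<in> borel_measurable (restrict_space F D)"
    using measurable_restrict_space1[OF f] measurable_cong_sets[OF trace refl] by blast
  then have "(\<lambda>x. indicator D x *\<^sub>R f x) \<in> borel_measurable F"
    using D by (simp add: borel_measurable_restrict_space_iff)
  also have "(\<lambda>x. indicator D x *\<^sub>R f x) = (\<lambda>x. indicator D x * X x)"
    using X_eq_f by (auto simp: indicator_def)
  finally have meas: "(\<lambda>x. indicator D x * X x) \<in> borel_measurable F" .
  have "D \<in> sets M"
    using D subalg by (auto simp: subalgebra_def)
  then have int: "integrable M (\<lambda>x. indicator D x * X x)"
    using integrable_mult_indicator[OF _ X] by simp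
  have "AE x in M. real_cond_exp M F (\<lambda>x. indicator D x * X x) x = indicator D x * X x"
    by (rule real_cond_exp_F_meas[OF int meas])
  moreover have "AE x in M. real_cond_exp M F (\<lambda>x. indicator D x * X x) x =
      indicator D x * real_cond_exp M F X x"
    using D X int by (intro real_cond_exp_mult) auto
  ultimately show ?thesis
    by eventually_elim auto
qed

lemma real_cond_exp_tower_on_trace:
  assumes "sigma_finite_subalgebra M G" "sigma_finite_subalgebra M H" and D: "D \<in> sets G"
    and trace: "sets (restrict_space G D) = sets (restrict_space H D)" and X: "integrable M X"
  shows "AE x in M. real_cond_exp M H (\<lambda>x. X x * indicator D x) x =
    real_cond_exp M H (\<lambda>x. real_cond_exp M G X x * indicator D x) x"
proof -
  interpret G: sigma_finite_subalgebra M G by fact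
  interpret H: sigma_finite_subalgebra M H by fact
  let ?g = "real_cond_exp M G X"
  have D_M: "D \<in> sets M"
    using D G.subalg by (auto simp: subalgebra_def)
  have int_X: "integrable M (\<lambda>x. X x * indicator D x)"
    using integrable_mult_indicator[OF D_M X] by (simp add: mult.commute)
  have int_g: "integrable M (\<lambda>x. ?g x * indicator D x)"
    using integrable_mult_indicator[OF D_M G.real_cond_exp_int(1)[OF X]] by (simp add: mult.commute)
  show ?thesis
  proof (rule H.real_cond_exp_charact[OF _ int_X])
    fix A assume A: "A \<in> sets H"
    then have "D \<inter> A \<in> sets (restrict_space G D)"
      unfolding trace by (auto simp: sets_restrict_space)
    then have DA: "D \<inter> A \<in> sets G"
      using D by (simp add: sets_restrict_space_iff)
    have "(\<integral>x\<in>A. X x * indicator D x \<partial>M) = (\<integral>x\<in>D \<inter> A. X x \<partial>M)"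
      by (simp add: set_lebesgue_integral_def indicator_inter_arith ac_simps)
    also have "\<dots> = (\<integral>x\<in>D \<inter> A. ?g x \<partial>M)"
      by (rule G.real_cond_exp_intA[OF X DA])
    also have "\<dots> = (\<integral>x\<in>A. ?g x * indicator D x \<partial>M)"
      by (simp add: set_lebesgue_integral_def indicator_inter_arith ac_simps)
    also have "\<dots> = (\<integral>x\<in>A. real_cond_exp M H (\<lambda>x. ?g x * indicator D x) x \<partial>M)"
      by (rule H.real_cond_exp_intA[OF int_g A])
    finally show "(\<integral>x\<in>A. X x * indicator D x \<partial>M) = \<dots>" .
  qed (use int_g in auto)
qed

lemma (in prob_space) real_cond_exp_Bayes_on_trace:
  assumes G: "subalgebra M G" and H: "subalgebra M H" and D: "D \<in> sets G"
    and trace: "sets (restrict_space G D) = sets (restrict_space H D)" and X: "integrable M X"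
  shows "AE x in M. x \<in> D \<longrightarrow> real_cond_exp M G X x =
    real_cond_exp M H (\<lambda>x. X x * indicator D x) x / real_cond_exp M H (indicator D) x"
proof -
  interpret G: finite_measure_subalgebra M G by unfold_locales (fact G)
  interpret H: finite_measure_subalgebra M H by unfold_locales (fact H)
  let ?g = "real_cond_exp M G X"
  have D_M: "D \<in> sets M" and space_H: "space H = space M"
    using D G H by (auto simp: subalgebra_def)
  have "?g \<in> borel_measurable (restrict_space G D)"
    by (intro measurable_restrict_space1) simp
  then have "?g \<in> borel_measurable (restrict_space H D)"
    using measurable_cong_sets[OF trace refl] by blast
  then obtain h where h: "h \<in> borel_measurable H"
    and h_eq: "\<And>x. x \<in> D \<Longrightarrow> x \<in> space H \<Longrightarrow> h x = ?g x"
    using borel_measurable_restrict_space_extend by blast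
  have g_D: "(\<lambda>x. ?g x * indicator D x) = (\<lambda>x. h x * indicator D x)"
    using h_eq sets.sets_into_space[OF D_M] by (auto simp: space_H indicator_def fun_eq_iff)
  have "integrable M (\<lambda>x. ?g x * indicator D x)"
    using integrable_mult_indicator[OF D_M G.real_cond_exp_int(1)[OF X]] by (simp add: mult.commute)
  then have "AE x in M. real_cond_exp M H (\<lambda>x. ?g x * indicator D x) x =
      h x * real_cond_exp M H (indicator D) x"
    unfolding g_D using h D_M by (intro H.real_cond_exp_mult) auto
  moreover have "AE x in M. real_cond_exp M H (\<lambda>x. X x * indicator D x) x =
      real_cond_exp M H (\<lambda>x. ?g x * indicator D x) x"
    by (rule real_cond_exp_tower_on_trace[OF G.sigma_finite_subalgebra_axioms
          H.sigma_finite_subalgebra_axioms D trace X])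
  moreover have "AE x in M. x \<in> D \<longrightarrow> 0 < real_cond_exp M H (indicator D) x"
    by (rule cond_prob_pos[OF prob_space_axioms H D_M])
  ultimately show ?thesis
    using AE_space by eventually_elim (use h_eq in \<open>auto simp: space_H\<close>)
qed

section \<open>The \<open>\<sigma>\<close>-algebra of the strict past\<close>

locale discrete_filtration = filtration \<Omega> F
  for \<Omega> :: "'a set" and F :: "nat \<Rightarrow> 'a measure"
begin

lemma F_subset_Pow: "(\<Union>n. sets (F n)) \<subseteq> Pow \<Omega>"
  using space_F sets.sets_into_space by fastforce

abbreviation strict_past_generators :: "('a \<Rightarrow> enat) \<Rightarrow> 'a set set" where
  "strict_past_generators T \<equiv> sets (F 0) \<union> {A \<inter> {\<omega> \<in> \<Omega>. enat n < T \<omega>} | A n. A \<in> sets (F n)}"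

lemma strict_past_generators_subset_Pow: "strict_past_generators T \<subseteq> Pow \<Omega>"
  using F_subset_Pow by blast

lemma space_strict_past [simp]: "space (strict_past \<Omega> F T) = \<Omega>"
  unfolding strict_past_def by (rule space_measure_of[OF strict_past_generators_subset_Pow])

lemma sets_strict_past: "sets (strict_past \<Omega> F T) = sigma_sets \<Omega> (strict_past_generators T)"
  unfolding strict_past_def by (rule sets_measure_of[OF strict_past_generators_subset_Pow])

lemma borel_measurable_strict_past: "T \<in> borel_measurable (strict_past \<Omega> F T)"
proof (rule borel_measurableI_greater)
  fix t
  show "{\<omega> \<in> space (strict_past \<Omega> F T). t < T \<omega>} \<in> sets (strict_past \<Omega> F T)"
  proof (cases t)
    case (enat n)
    have "{\<omega> \<in> \<Omega>. enat n < T \<omega>} = space (F n) \<inter> {\<omega> \<in> \<Omega>. enat n < T \<omega>}"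
      by (auto simp: space_F)
    then show ?thesis
      unfolding enat space_strict_past unfolding sets_strict_past
      by (intro sigma_sets.Basic) blast
  qed simp
qed

lemma sets_restrict_space_strict_past_cong:
  assumes "D \<subseteq> \<Omega>" "\<And>\<omega>. \<omega> \<in> D \<Longrightarrow> S \<omega> = T \<omega>"
  shows "sets (restrict_space (strict_past \<Omega> F S) D) = sets (restrict_space (strict_past \<Omega> F T) D)"
proof -
  have "(A \<inter> {\<omega> \<in> \<Omega>. enat n < S \<omega>}) \<inter> D = (A \<inter> {\<omega> \<in> \<Omega>. enat n < T \<omega>}) \<inter> D" for A n
    using assms(2) by auto
  then have "{B \<inter> D | B. B \<in> strict_past_generators S} = {B \<inter> D | B. B \<in> strict_past_generators T}"
    by blast
  then show ?thesis
    unfolding strict_past_def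
      sets_restrict_space_sigma[OF strict_past_generators_subset_Pow assms(1)]
    by simp
qed

(* The case n = 0 is included: the strict past of time 0 is F 0, and n - 1 is truncated. *)
lemma sets_strict_past_const_enat: "sets (strict_past \<Omega> F (\<lambda>_. enat n)) = sets (F (n - 1))"
proof -
  have "strict_past_generators (\<lambda>_. enat n) = sets (F (n - 1))"
  proof (intro equalityI subsetI)
    fix B assume "B \<in> strict_past_generators (\<lambda>_. enat n)"
    then consider (initial) "B \<in> sets (F 0)"
      | (cut) A m where "A \<in> sets (F m)" "B = A \<inter> {\<omega> \<in> \<Omega>. m < n}"
      by auto
    then show "B \<in> sets (F (n - 1))"
    proof cases
      case initial
      then show ?thesis
        using sets_F_mono[of 0 "n - 1"] by auto
    next
      case (cut A m)
      show ?thesis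
      proof (cases "m < n")
        case True
        then have "B = A" "m \<le> n - 1"
          using cut sets.Int_space_eq2[of A "F m"] by (auto simp: space_F)
        then show ?thesis
          using cut sets_F_mono by auto
      qed (use cut in simp)
    qed
  next
    fix B assume B: "B \<in> sets (F (n - 1))"
    show "B \<in> strict_past_generators (\<lambda>_. enat n)"
    proof (cases n)
      case (Suc m)
      have "B = B \<inter> {\<omega> \<in> \<Omega>. enat m < enat n}"
        using sets.Int_space_eq2[OF B] Suc by (simp add: space_F)
      then show ?thesis
        using B Suc by auto
    qed (use B in simp)
  qed
  then show ?thesis
    using sets.sigma_sets_eq[of "F (n - 1)"] by (simp add: sets_strict_past space_F)
qed

lemma sets_strict_past_const_infinity:
  "sets (strict_past \<Omega> F (\<lambda>_. \<infinity>)) = sigma_sets \<Omega> (\<Union>n. sets (F n))"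
proof -
  have Int_space: "A \<inter> {\<omega> \<in> \<Omega>. enat n < \<infinity>} = A" if "A \<in> sets (F n)" for A n
    using sets.Int_space_eq2[OF that] by (simp add: space_F)
  have "strict_past_generators (\<lambda>_. \<infinity>) = (\<Union>n. sets (F n))"
  proof (intro equalityI subsetI)
    fix B assume "B \<in> strict_past_generators (\<lambda>_. \<infinity>)"
    then show "B \<in> (\<Union>n. sets (F n))"
      using Int_space by fastforce
  next
    fix B assume "B \<in> (\<Union>n. sets (F n))"
    then obtain n where "B \<in> sets (F n)"
      by auto
    then show "B \<in> strict_past_generators (\<lambda>_. \<infinity>)"
      using Int_space[of B n] by (intro UnI2 CollectI exI[of _ B] exI[of _ n]) simp
  qed
  then show ?thesis
    by (simp add: sets_strict_past)
qed

lemma space_extended_filtration [simp]: "space (extended_filtration \<Omega> F t) = \<Omega>"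
  by (cases t) (auto simp: extended_filtration_def space_F space_measure_of[OF F_subset_Pow])

lemma sets_extended_filtration_infinity:
  "sets (extended_filtration \<Omega> F \<infinity>) = sigma_sets \<Omega> (\<Union>n. sets (F n))"
  by (simp add: extended_filtration_def sets_measure_of[OF F_subset_Pow])

lemma filtration_extended_filtration: "filtration \<Omega> (extended_filtration \<Omega> F)"
proof
  fix s t :: enat assume "s \<le> t"
  moreover have "sets (extended_filtration \<Omega> F (enat n)) \<subseteq> sets (extended_filtration \<Omega> F \<infinity>)" for n
    unfolding sets_extended_filtration_infinity by (auto simp: extended_filtration_def)
  ultimately show "sets (extended_filtration \<Omega> F s) \<subseteq> sets (extended_filtration \<Omega> F t)"
    by (cases s; cases t) (auto simp: extended_filtration_def sets_F_mono[THEN subsetD])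
qed simp

lemma sets_strict_past_subset_extended_filtration:
  assumes "stopping_time (extended_filtration \<Omega> F) T"
  shows "sets (strict_past \<Omega> F T) \<subseteq> sets (extended_filtration \<Omega> F \<infinity>)"
proof -
  have "{\<omega> \<in> \<Omega>. enat n < T \<omega>} \<in> sets (F n)" for n
    using stopping_timeD2[OF assms, of "enat n"]
    by (simp add: pred_def extended_filtration_def space_F)
  then have "strict_past_generators T \<subseteq> (\<Union>n. sets (F n))"
    by blast
  then show ?thesis
    unfolding sets_strict_past sets_extended_filtration_infinity by (rule sigma_sets_mono')
qed

end

section \<open>The density process at a stopping time\<close>

lemma nn_integral_abs_RN_deriv_version:
  fixes f :: "'a \<Rightarrow> real"
  assumes "sigma_finite_measure M" "sigma_finite_measure N"
    and "absolutely_continuous M N" "sets N = sets M"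
    and f: "AE x in M. f x = enn2real (RN_deriv M N x)" and A: "A \<in> sets M"
  shows "(\<integral>\<^sup>+x\<in>A. ennreal \<bar>f x\<bar> \<partial>M) = emeasure N A"
proof -
  interpret M: sigma_finite_measure M by fact
  have "AE x in M. RN_deriv M N x \<noteq> \<infinity>"
    by (rule M.RN_deriv_finite) fact+
  with f have "AE x in M. ennreal \<bar>f x\<bar> * indicator A x = RN_deriv M N x * indicator A x"
    by eventually_elim (simp add: less_top)
  then have "(\<integral>\<^sup>+x\<in>A. ennreal \<bar>f x\<bar> \<partial>M) = (\<integral>\<^sup>+x\<in>A. RN_deriv M N x \<partial>M)"
    by (rule nn_integral_cong_AE)
  also have "\<dots> = emeasure (density M (RN_deriv M N)) A"
    using A by (simp add: emeasure_density)
  also have "density M (RN_deriv M N) = N"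
    by (rule M.density_RN_deriv) fact+
  finally show ?thesis .
qed

lemma absolutely_continuous_restr_to_subalg:
  assumes "absolutely_continuous M N" "subalgebra M G" "subalgebra N G"
  shows "absolutely_continuous (restr_to_subalg M G) (restr_to_subalg N G)"
  using assms by (auto simp: absolutely_continuous_def null_sets_restr_to_subalg)

lemma nn_integral_abs_RN_deriv_restr_to_subalg_version:
  fixes f :: "'a \<Rightarrow> real"
  assumes "sigma_finite_subalgebra M G" "sigma_finite_subalgebra N G"
    and ac: "absolutely_continuous M N" and f: "f \<in> borel_measurable G"
      "AE x in restr_to_subalg M G.
        f x = enn2real (RN_deriv (restr_to_subalg M G) (restr_to_subalg N G) x)"
    and A: "A \<in> sets G"
  shows "(\<integral>\<^sup>+x\<in>A. ennreal \<bar>f x\<bar> \<partial>M) = emeasure N A"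
proof -
  interpret M: sigma_finite_subalgebra M G by fact
  interpret N: sigma_finite_subalgebra N G by fact
  have "(\<integral>\<^sup>+x\<in>A. ennreal \<bar>f x\<bar> \<partial>M) = (\<integral>\<^sup>+x\<in>A. ennreal \<bar>f x\<bar> \<partial>restr_to_subalg M G)"
    using f(1) A by (intro nn_integral_subalgebra2[OF M.subalg, symmetric]) auto
  also have "\<dots> = emeasure (restr_to_subalg N G) A"
    using absolutely_continuous_restr_to_subalg[OF ac M.subalg N.subalg] f(2) A
    by (intro nn_integral_abs_RN_deriv_version M.sigma_fin_subalg N.sigma_fin_subalg)
      (auto simp: sets_restr_to_subalg M.subalg N.subalg)
  also have "\<dots> = emeasure N A"
    by (rule emeasure_restr_to_subalg[OF N.subalg A])
  finally show ?thesis .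
qed

lemma nn_integral_countable_partition:
  fixes f :: "'b::countable \<Rightarrow> 'a \<Rightarrow> ennreal"
  assumes [measurable]: "\<And>i. f i \<in> borel_measurable M"
    and X: "\<And>i. {x \<in> space M. X x = i} \<in> sets M"
  shows "(\<integral>\<^sup>+x. f (X x) x \<partial>M) = (\<integral>\<^sup>+i. (\<integral>\<^sup>+x\<in>{x \<in> space M. X x = i}. f i x \<partial>M) \<partial>count_space UNIV)"
proof -
  have "(\<integral>\<^sup>+x. f (X x) x \<partial>M) =
      (\<integral>\<^sup>+x. \<integral>\<^sup>+i. f i x * indicator {x \<in> space M. X x = i} x \<partial>count_space UNIV \<partial>M)"
  proof (rule nn_integral_cong)
    fix x assume "x \<in> space M"
    then have "(\<integral>\<^sup>+i. f i x * indicator {x \<in> space M. X x = i} x \<partial>count_space UNIV) =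
        (\<integral>\<^sup>+i. f i x * indicator {X x} i \<partial>count_space UNIV)"
      by (intro nn_integral_cong) (auto simp: indicator_def)
    then show "f (X x) x = (\<integral>\<^sup>+i. f i x * indicator {x \<in> space M. X x = i} x \<partial>count_space UNIV)"
      by simp
  qed
  also have "\<dots> = (\<integral>\<^sup>+i. (\<integral>\<^sup>+x\<in>{x \<in> space M. X x = i}. f i x \<partial>M) \<partial>count_space UNIV)"
    using X by (intro nn_integral_count_space_nn_integral) auto
  finally show ?thesis .
qed

locale stopped_density_process =
  P: prob_space P + \<mu>: prob_space \<mu> + discrete_filtration "space P" F
  for P \<mu> :: "'a measure" and F :: "nat \<Rightarrow> 'a measure" +
  fixes z :: "enat \<Rightarrow> 'a \<Rightarrow> real" and T :: "'a \<Rightarrow> enat"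
  assumes sets_\<mu>: "sets \<mu> = sets P"
    and sets_P: "sets P = sigma_sets (space P) (\<Union>n. sets (F n))"
    and absolutely_continuous: "absolutely_continuous P \<mu>"
    and density_process: "density_process P \<mu> F z"
    and stopping_time: "stopping_time (extended_filtration (space P) F) T"
begin

abbreviation z_T :: "'a \<Rightarrow> real" where
  "z_T \<omega> \<equiv> z (T \<omega>) \<omega>"

abbreviation T_eq :: "enat \<Rightarrow> 'a set" where
  "T_eq t \<equiv> {\<omega> \<in> space P. T \<omega> = t}"

abbreviation F_T_minus :: "'a measure" where
  "F_T_minus \<equiv> strict_past (space P) F T"

lemma subalgebra_extended_filtration: "subalgebra P (extended_filtration (space P) F t)"
  using filtration.sets_F_mono[OF filtration_extended_filtration, of t \<infinity>]
  by (simp add: subalgebra_def sets_P sets_extended_filtration_infinity)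

lemma subalgebra_F: "subalgebra P (F n)"
  using subalgebra_extended_filtration[of "enat n"] by (simp add: extended_filtration_def)

lemma subalgebra_F_T_minus: "subalgebra P F_T_minus"
  using sets_strict_past_subset_extended_filtration[OF stopping_time]
  by (simp add: subalgebra_def sets_P sets_extended_filtration_infinity)

lemma T_eq_in_F_T_minus: "T_eq t \<in> sets F_T_minus"
  using measurable_sets[OF borel_measurable_strict_past, of "{t}" T]
  by (simp add: vimage_def Int_def conj_commute)

lemma T_eq_in_extended_filtration:
  "T_eq t \<in> sets (extended_filtration (space P) F t)"
  using filtration.stopping_time_eq_const[OF filtration_extended_filtration stopping_time]
  by (simp add: pred_def)

lemma T_eq_in_P: "T_eq t \<in> sets P"
  using T_eq_in_F_T_minus subalgebra_F_T_minus by (auto simp: subalgebra_def)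

lemma borel_measurable_z: "z t \<in> borel_measurable (extended_filtration (space P) F t)"
proof (cases t)
  case infinity
  have "sets (extended_filtration (space P) F \<infinity>) = sets P"
    by (simp add: sets_extended_filtration_infinity sets_P)
  then show ?thesis
    using density_process measurable_cong_sets[OF _ refl]
    unfolding density_process_def infinity by blast
qed (use density_process in \<open>auto simp: density_process_def extended_filtration_def\<close>)

lemma borel_measurable_z_P [measurable]: "z t \<in> borel_measurable P"
  by (rule measurable_from_subalg[OF subalgebra_extended_filtration borel_measurable_z])

lemma nn_integral_abs_z:
  assumes A: "A \<in> sets (extended_filtration (space P) F t)"
  shows "(\<integral>\<^sup>+\<omega>\<in>A. ennreal \<bar>z t \<omega>\<bar> \<partial>P) = emeasure \<mu> A"
proof (cases t)
  case infinity
  then have "A \<in> sets P"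
    using A by (simp add: sets_extended_filtration_infinity sets_P)
  then show ?thesis
    using density_process unfolding density_process_def infinity
    by (intro nn_integral_abs_RN_deriv_version P.sigma_finite_measure_axioms
        \<mu>.sigma_finite_measure_axioms absolutely_continuous sets_\<mu>) auto
next
  case (enat n)
  interpret P_n: finite_measure_subalgebra P "F n"
    by unfold_locales (rule subalgebra_F)
  interpret \<mu>_n: finite_measure_subalgebra \<mu> "F n"
    using subalgebra_F[of n] sets_eq_imp_space_eq[OF sets_\<mu>]
    by unfold_locales (simp add: subalgebra_def sets_\<mu>)
  have "A \<in> sets (F n)"
    using A by (simp add: enat extended_filtration_def)
  then show ?thesis
    using density_process unfolding density_process_def enat
    by (intro nn_integral_abs_RN_deriv_restr_to_subalg_version[where G = "F n"]
        absolutely_continuous P_n.sigma_finite_subalgebra_axioms \<mu>_n.sigma_finite_subalgebra_axioms) auto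
qed

lemma nn_integral_abs_z_T: "(\<integral>\<^sup>+\<omega>. ennreal \<bar>z_T \<omega>\<bar> \<partial>P) = 1"
proof -
  have "(\<integral>\<^sup>+\<omega>. ennreal \<bar>z_T \<omega>\<bar> \<partial>P) =
      (\<integral>\<^sup>+t. (\<integral>\<^sup>+\<omega>\<in>T_eq t. ennreal \<bar>z t \<omega>\<bar> \<partial>P) \<partial>count_space UNIV)"
    by (rule nn_integral_countable_partition) (use T_eq_in_P in auto)
  also have "\<dots> = (\<integral>\<^sup>+t. emeasure \<mu> (T_eq t) \<partial>count_space UNIV)"
    by (simp add: nn_integral_abs_z[OF T_eq_in_extended_filtration])
  also have "\<dots> = emeasure \<mu> (\<Union>t. T_eq t)"
    using T_eq_in_P
    by (intro emeasure_UN_countable[symmetric]) (auto simp: sets_\<mu> disjoint_family_on_def)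
  also have "(\<Union>t. T_eq t) = space \<mu>"
    using sets_eq_imp_space_eq[OF sets_\<mu>] by auto
  finally show ?thesis
    by (simp add: \<mu>.emeasure_space_1)
qed

lemma integrable_z_T: "integrable P z_T"
proof (rule integrableI_bounded)
  have "T \<in> P \<rightarrow>\<^sub>M count_space UNIV"
    using T_eq_in_P
    by (simp add: measurable_count_space_eq2_countable vimage_def Int_def conj_commute)
  then show "z_T \<in> borel_measurable P"
    by (rule measurable_compose_countable[OF borel_measurable_z_P])
  show "(\<integral>\<^sup>+\<omega>. ennreal (norm (z_T \<omega>)) \<partial>P) < \<infinity>"
    by (simp add: nn_integral_abs_z_T)
qed

lemma sets_restrict_space_F_T_minus:
  "sets (restrict_space F_T_minus (T_eq t)) =
    sets (restrict_space (strict_past (space P) F (\<lambda>_. t)) (T_eq t))"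
  by (rule sets_restrict_space_strict_past_cong) auto

lemma real_cond_exp_z_T_at_0_infinity:
  "AE \<omega> in P. T \<omega> = 0 \<or> T \<omega> = \<infinity> \<longrightarrow> real_cond_exp P F_T_minus z_T \<omega> = z_T \<omega>"
proof -
  interpret finite_measure_subalgebra P F_T_minus
    by unfold_locales (rule subalgebra_F_T_minus)
  have on_T_eq: "AE \<omega> in P. \<omega> \<in> T_eq t \<longrightarrow> real_cond_exp P F_T_minus z_T \<omega> = z_T \<omega>"
    if "t = 0 \<or> t = \<infinity>" for t
  proof -
    have "sets (strict_past (space P) F (\<lambda>_. t)) = sets (extended_filtration (space P) F t)"
      using that
    proof
      assume "t = 0"
      then show ?thesis
        using sets_strict_past_const_enat[of 0] by (simp add: zero_enat_def extended_filtration_def)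
    qed (simp add: sets_strict_past_const_infinity sets_extended_filtration_infinity)
    then have "z t \<in> borel_measurable (strict_past (space P) F (\<lambda>_. t))"
      using borel_measurable_z measurable_cong_sets[OF _ refl] by blast
    then show ?thesis
      by (rule real_cond_exp_eq_on_trace[OF T_eq_in_F_T_minus sets_restrict_space_F_T_minus
            _ integrable_z_T]) simp
  qed
  from on_T_eq[OF disjI1[OF refl]] on_T_eq[OF disjI2[OF refl]] show ?thesis
    using AE_space by eventually_elim auto
qed

lemma real_cond_exp_z_T_at_enat:
  "AE \<omega> in P. T \<omega> = enat n \<longrightarrow> real_cond_exp P F_T_minus z_T \<omega> =
    real_cond_exp P (F (n - 1)) (\<lambda>\<omega>. z (enat n) \<omega> * indicator (T_eq (enat n)) \<omega>) \<omega> /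
    real_cond_exp P (F (n - 1)) (indicator (T_eq (enat n))) \<omega>"
proof -
  let ?D = "T_eq (enat n)"
  have trace: "sets (restrict_space F_T_minus ?D) = sets (restrict_space (F (n - 1)) ?D)"
    unfolding sets_restrict_space_F_T_minus
    by (rule sets_restrict_space_cong[OF sets_strict_past_const_enat])
  have z_T_eq: "(\<lambda>\<omega>. z_T \<omega> * indicator ?D \<omega>) = (\<lambda>\<omega>. z (enat n) \<omega> * indicator ?D \<omega> :: real)"
    by (auto simp: indicator_def)
  have "AE \<omega> in P. \<omega> \<in> ?D \<longrightarrow> real_cond_exp P F_T_minus z_T \<omega> =
      real_cond_exp P (F (n - 1)) (\<lambda>\<omega>. z (enat n) \<omega> * indicator ?D \<omega>) \<omega> /
      real_cond_exp P (F (n - 1)) (indicator ?D) \<omega>"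
    unfolding z_T_eq[symmetric]
    by (rule P.real_cond_exp_Bayes_on_trace[OF subalgebra_F_T_minus subalgebra_F T_eq_in_F_T_minus
        trace integrable_z_T])
  then show ?thesis
    using AE_space by eventually_elim simp
qed

end

theorem theorem5:
  fixes P \<mu> :: "'a measure" and F :: "nat \<Rightarrow> 'a measure"
    and z :: "enat \<Rightarrow> 'a \<Rightarrow> real" and T :: "'a \<Rightarrow> enat"
  assumes "prob_space P" and "prob_space \<mu>" and "sets \<mu> = sets P"
    and "filtration (space P) F"
    and "sets P = sigma_sets (space P) (\<Union>n. sets (F n))"
    and "absolutely_continuous P \<mu>"
    and "density_process P \<mu> F z"
    and "stopping_time (extended_filtration (space P) F) T"
  shows "AE \<omega> in P.
    ((T \<omega> = 0 \<or> T \<omega> = \<infinity>) \<longrightarrow>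
      real_cond_exp P (strict_past (space P) F T) (\<lambda>\<omega>. z (T \<omega>) \<omega>) \<omega> = z (T \<omega>) \<omega>) \<and>
    (\<forall>n\<ge>1. T \<omega> = enat n \<longrightarrow>
      real_cond_exp P (strict_past (space P) F T) (\<lambda>\<omega>. z (T \<omega>) \<omega>) \<omega> =
        real_cond_exp P (F (n - 1)) (\<lambda>\<omega>. z (enat n) \<omega> * indicator {\<omega> \<in> space P. T \<omega> = enat n} \<omega>) \<omega> /
        real_cond_exp P (F (n - 1)) (indicator {\<omega> \<in> space P. T \<omega> = enat n}) \<omega>)"
proof -
  interpret stopped_density_process P \<mu> F z T
    using assms by (intro stopped_density_process.intro discrete_filtration.intro
        stopped_density_process_axioms.intro)
  have "AE \<omega> in P. \<forall>n. T \<omega> = enat n \<longrightarrow> real_cond_exp P F_T_minus z_T \<omega> =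
      real_cond_exp P (F (n - 1)) (\<lambda>\<omega>. z (enat n) \<omega> * indicator (T_eq (enat n)) \<omega>) \<omega> /
      real_cond_exp P (F (n - 1)) (indicator (T_eq (enat n))) \<omega>"
    using real_cond_exp_z_T_at_enat by (simp add: AE_all_countable)
  with real_cond_exp_z_T_at_0_infinity show ?thesis
    by eventually_elim auto
qed

end
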